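(* Let $a<b$ and $c<d$ be real numbers, let $\Delta=[a,b]\times[c,d]$, and let $F,G:\Delta\to\mathbb{R}_{\mathcal{I}}^{+}$ be two interval-valued co-ordinated convex functions, with $F(x,y)=[\underline{F}(x,y),\overline{F}(x,y)]$ and $G(x,y)=[\underline{G}(x,y),\overline{G}(x,y)]$. Then $$\frac{1}{(b-a)(d-c)}\int_a^b\int_c^d F(x,y)G(x,y)\,dy\,dx\supseteq \frac19P(a,b,c,d)+\frac1{18}M(a,b,c,d)+\frac1{36}N(a,b,c,d),$$ where \begin{align*} P(a,b,c,d)&=F(a,c)G(a,c)+F(a,d)G(a,d)+F(b,c)G(b,c)+F(b,d)G(b,d),\\ M(a,b,c,d)&=F(a,c)G(a,d)+F(a,d)G(a,c)+F(b,c)G(b,d)+F(b,d)G(b,c)\\ &\quad+F(b,c)G(a,c)+F(a,c)G(b,c)+F(b,d)G(a,d)+F(a,d)G(b,d),\\ N(a,b,c,d)&=F(b,c)G(a,d)+F(a,d)G(b,c)+F(b,d)G(a,c)+F(a,c)G(b,d). \end{align*}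
   Context: $\mathbb{R}_{\mathcal{I}}^{+}$ denotes the family of all positive closed bounded intervals $X=[\underline{X},\overline{X}]$ of $\mathbb{R}$, i.e. $0<\underline{X}\le\overline{X}$ (degenerate intervals $\underline{X}=\overline{X}$ are allowed). Interval operations: $X+Y=[\underline{X}+\underline{Y},\overline{X}+\overline{Y}]$; for $\lambda\ge 0$, $\lambda X=[\lambda\underline{X},\lambda\overline{X}]$; and for positive intervals $XY=[\underline{X}\,\underline{Y},\overline{X}\,\overline{Y}]$. The relation $\supseteq$ is set inclusion: $X\supseteq Y$ iff $\underline{X}\le\underline{Y}$ and $\overline{Y}\le\overline{X}$. A function $F:\Delta=[a,b]\times[c,d]\to\mathbb{R}_{\mathcal{I}}^{+}$ is interval-valued co-ordinated convex if for all $x,y\in[a,b]$, all $u,w\in[c,d]$ and all $s,t\in[0,1]$, $$F(tx+(1-t)y,\,su+(1-s)w)\supseteq tsF(x,u)+t(1-s)F(x,w)+s(1-t)F(y,u)+(1-s)(1-t)F(y,w).$$ Integrals are interval-valued Riemann integrals: an interval-valued function $H=[\underline{H},\overline{H}]$ on $[p,q]$ is integrable iff $\underline{H}$ and $\overline{H}$ are Riemann integrable, and then $\int_p^q H(t)\,dt=\left[\int_p^q\underline{H}(t)\,dt,\int_p^q\overline{H}(t)\,dt\right]$. The double integral over $\Delta$ is the interval-valued double Riemann integral, which equals the iterated integral. *)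

theory Defs
  imports "HOL-Analysis.Analysis" "HOL-Library.Interval"
begin

text \<open>
  Compact intervals are elements of \<^typ>\<open>real interval\<close>; addition and multiplication are the
  library's interval operations, and \<open>X \<supseteq> Y\<close> is written with \<^const>\<open>set_of\<close>.
\<close>

definition pos_interval :: "real interval \<Rightarrow> bool"
  where "pos_interval X \<longleftrightarrow> 0 < lower X"

definition scale_interval :: "real \<Rightarrow> real interval \<Rightarrow> real interval"  (infixr "*\<^sub>I" 75)
  where "r *\<^sub>I X = interval_of r * X"

lemma lower_scale_interval: "0 \<le> r \<Longrightarrow> lower (r *\<^sub>I X) = r * lower X"
  and upper_scale_interval: "0 \<le> r \<Longrightarrow> upper (r *\<^sub>I X) = r * upper X"
  by (simp_all add: scale_interval_def lower_times upper_times min_def max_def mult_left_mono)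

lemma
  assumes "pos_interval X" "pos_interval Y"
  shows lower_times_pos: "lower (X * Y) = lower X * lower Y"
    and upper_times_pos: "upper (X * Y) = upper X * upper Y"
proof -
  have pos: "0 \<le> lower X" "0 \<le> lower Y" "0 \<le> upper X" "0 \<le> upper Y"
    using assms lower_le_upper[of X] lower_le_upper[of Y] unfolding pos_interval_def by linarith+
  have "lower X * lower Y \<le> lower X * upper Y" "lower X * lower Y \<le> upper X * lower Y"
    "lower X * upper Y \<le> upper X * upper Y" "upper X * lower Y \<le> upper X * upper Y"
    using pos by (auto intro: mult_left_mono mult_right_mono)
  then show "lower (X * Y) = lower X * lower Y" "upper (X * Y) = upper X * upper Y"
    by (simp_all add: lower_times upper_times)
qed

definition ivl_coord_convex_on ::
    "real set \<Rightarrow> real set \<Rightarrow> (real \<Rightarrow> real \<Rightarrow> real interval) \<Rightarrow> bool"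
  where "ivl_coord_convex_on A B F \<longleftrightarrow>
    (\<forall>x\<in>A. \<forall>y\<in>A. \<forall>u\<in>B. \<forall>w\<in>B. \<forall>s\<in>{0..1}. \<forall>t\<in>{0..1}.
      set_of (F (t * x + (1 - t) * y) (s * u + (1 - s) * w)) \<supseteq>
      set_of ((t * s) *\<^sub>I F x u + (t * (1 - s)) *\<^sub>I F x w
            + (s * (1 - t)) *\<^sub>I F y u + ((1 - s) * (1 - t)) *\<^sub>I F y w))"

text \<open>
  Riemann integral over a compact box: the same condition as for the gauge integral
  \<^const>\<open>has_integral\<close>, but with a gauge of constant radius \<open>\<delta>\<close>, that is, a bound on the mesh.
  For \<^typ>\<open>real \<times> real\<close> this is the double Riemann integral.
\<close>

definition has_riemann_integral :: "('a::euclidean_space \<Rightarrow> real) \<Rightarrow> real \<Rightarrow> 'a set \<Rightarrow> bool"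
  where "has_riemann_integral f I S \<longleftrightarrow>
    (\<exists>p q. S = cbox p q) \<and>
    (\<forall>\<epsilon>>0. \<exists>\<delta>>0. \<forall>\<D>. \<D> tagged_division_of S \<and> (\<lambda>x. ball x \<delta>) fine \<D> \<longrightarrow>
        \<bar>(\<Sum>(x, K)\<in>\<D>. measure lborel K * f x) - I\<bar> < \<epsilon>)"

lemma has_riemann_integral_imp_has_integral:
  assumes "has_riemann_integral f I S"
  shows "(f has_integral I) S"
proof -
  obtain p q where S: "S = cbox p q"
    using assms by (auto simp: has_riemann_integral_def)
  have "\<exists>\<gamma>. gauge \<gamma> \<and> (\<forall>\<D>. \<D> tagged_division_of cbox p q \<and> \<gamma> fine \<D> \<longrightarrow>
      norm ((\<Sum>(x, K)\<in>\<D>. measure lborel K *\<^sub>R f x) - I) < \<epsilon>)" if "\<epsilon> > 0" for \<epsilon>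
  proof -
    obtain \<delta> where "\<delta> > 0" and "\<forall>\<D>. \<D> tagged_division_of S \<and> (\<lambda>x. ball x \<delta>) fine \<D> \<longrightarrow>
        \<bar>(\<Sum>(x, K)\<in>\<D>. measure lborel K * f x) - I\<bar> < \<epsilon>"
      using assms \<open>\<epsilon> > 0\<close> unfolding has_riemann_integral_def by blast
    then show ?thesis
      by (intro exI[of _ "\<lambda>x. ball x \<delta>"]) (simp add: S gauge_ball)
  qed
  then show ?thesis
    unfolding S has_integral by blast
qed

definition has_ivl_integral ::
    "('a::euclidean_space \<Rightarrow> real interval) \<Rightarrow> real interval \<Rightarrow> 'a set \<Rightarrow> bool"
  where "has_ivl_integral H J S \<longleftrightarrow>
    has_riemann_integral (\<lambda>z. lower (H z)) (lower J) S \<and>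
    has_riemann_integral (\<lambda>z. upper (H z)) (upper J) S"

lemma has_ivl_integral_unique:
  "has_ivl_integral H J S \<Longrightarrow> has_ivl_integral H J' S \<Longrightarrow> J = J'"
  by (auto simp: has_ivl_integral_def interval_eq_iff
      dest!: has_riemann_integral_imp_has_integral intro: has_integral_unique)

definition ivl_integrable_on :: "('a::euclidean_space \<Rightarrow> real interval) \<Rightarrow> 'a set \<Rightarrow> bool"
  where "ivl_integrable_on H S \<longleftrightarrow>
    (\<exists>I. has_riemann_integral (\<lambda>z. lower (H z)) I S) \<and>
    (\<exists>I. has_riemann_integral (\<lambda>z. upper (H z)) I S)"

definition ivl_integral :: "'a::euclidean_space set \<Rightarrow> ('a \<Rightarrow> real interval) \<Rightarrow> real interval"
  where "ivl_integral S H = (THE J. has_ivl_integral H J S)"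

lemma ivl_integral_eq: "has_ivl_integral H J S \<Longrightarrow> ivl_integral S H = J"
  unfolding ivl_integral_def by (blast intro: has_ivl_integral_unique)

lemma ivl_integrable_on_iff: "ivl_integrable_on H S \<longleftrightarrow> (\<exists>J. has_ivl_integral H J S)"
proof
  assume "ivl_integrable_on H S"
  then obtain l u where lu: "has_riemann_integral (\<lambda>z. lower (H z)) l S"
      "has_riemann_integral (\<lambda>z. upper (H z)) u S"
    by (auto simp: ivl_integrable_on_def)
  then have "l \<le> u"
    by (auto dest!: has_riemann_integral_imp_has_integral intro: has_integral_le)
  then obtain J where "lower J = l" "upper J = u"
    by (cases "Interval' l u") (auto split: Interval'_splits)
  with lu show "\<exists>J. has_ivl_integral H J S"
    by (auto simp: has_ivl_integral_def)
qed (auto simp: ivl_integrable_on_def has_ivl_integral_def)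

definition P_sum :: "(real \<Rightarrow> real \<Rightarrow> real interval) \<Rightarrow> (real \<Rightarrow> real \<Rightarrow> real interval)
    \<Rightarrow> real \<Rightarrow> real \<Rightarrow> real \<Rightarrow> real \<Rightarrow> real interval"
  where "P_sum F G a b c d =
    F a c * G a c + F a d * G a d + F b c * G b c + F b d * G b d"

definition M_sum :: "(real \<Rightarrow> real \<Rightarrow> real interval) \<Rightarrow> (real \<Rightarrow> real \<Rightarrow> real interval)
    \<Rightarrow> real \<Rightarrow> real \<Rightarrow> real \<Rightarrow> real \<Rightarrow> real interval"
  where "M_sum F G a b c d =
    F a c * G a d + F a d * G a c + F b c * G b d + F b d * G b c
    + F b c * G a c + F a c * G b c + F b d * G a d + F a d * G b d"

definition N_sum :: "(real \<Rightarrow> real \<Rightarrow> real interval) \<Rightarrow> (real \<Rightarrow> real \<Rightarrow> real interval)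
    \<Rightarrow> real \<Rightarrow> real \<Rightarrow> real \<Rightarrow> real \<Rightarrow> real interval"
  where "N_sum F G a b c d =
    F b c * G a d + F a d * G b c + F b d * G a c + F a c * G b d"

end

theory Submission
  imports Defs
begin

text \<open>
  Reading the inclusion at the end points of the intervals splits it into two real inequalities.
  Co-ordinated convexity of \<open>F\<close> says that \<open>lower F\<close> and \<open>- upper F\<close> are convex in each variable
  separately, so on the rectangle \<open>lower F\<close> lies below, and \<open>upper F\<close> above, the bilinear function
  with the same values at the four corners (\<open>biconvex_on_le_bilinear_interp\<close>). Positivity allows the
  bounds for \<open>F\<close> and \<open>G\<close> to be multiplied. The integral of a product of two bilinear interpolants is
  elementary: per variable the hat functions \<open>(b - x) / (b - a)\<close> and \<open>(x - a) / (b - a)\<close> contribute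
  \<open>1 / 3\<close> if the same one occurs in both factors and \<open>1 / 6\<close> otherwise. In two variables a product
  of corner values thus gets weight \<open>1 / 9\<close> for equal corners, \<open>1 / 18\<close> for corners on a common edge
  and \<open>1 / 36\<close> for opposite corners (\<open>has_integral_bilinear_interp_mult\<close>).

  The integrability of the product has to be proved too, in the sense of Riemann sums with small
  mesh. A separately convex function on a compact rectangle may jump at the boundary, but it is
  bounded (\<open>biconvex_on_bounded\<close>) and continuous in the interior
  (\<open>biconvex_on_continuous_on_box\<close>). Both properties pass to products, and together they imply
  Riemann integrability (\<open>has_riemann_integral_if_continuous_on_box\<close>).
\<close>

section \<open>Riemann integrability of bounded functions continuous inside a box\<close>

text \<open>
  The Lebesgue criterion in the case of discontinuities confined to the boundary. A compact
  \<open>T\<close> fills the open box up to small measure, and by compactness \<open>f\<close> has small oscillation on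
  every sufficiently small cell that meets \<open>T\<close>; on the other cells the crude bound is good enough.
  A single majorant \<open>g\<close> of the oscillation covers both kinds of cell, and the error of any fine
  Riemann sum is at most the integral of \<open>g\<close>.
\<close>

lemma has_riemann_integral_if_continuous_on_box:
  fixes f :: "'a::euclidean_space \<Rightarrow> real"
  assumes cont: "continuous_on (box p q) f"
    and bound: "\<And>x. x \<in> cbox p q \<Longrightarrow> \<bar>f x\<bar> \<le> C"
  shows "has_riemann_integral f (integral (cbox p q) f) (cbox p q)"
proof -
  define D where "D = max C 0"
  have D: "D \<ge> 0" "\<And>x. x \<in> cbox p q \<Longrightarrow> \<bar>f x\<bar> \<le> D"
    using bound by (force simp: D_def)+
  have int_f: "f integrable_on cbox p q"
  proof -
    have "f absolutely_integrable_on box p q"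
    proof (rule measurable_bounded_by_integrable_imp_absolutely_integrable)
      show "f \<in> borel_measurable (lebesgue_on (box p q))"
        by (intro continuous_imp_measurable_on_sets_lebesgue cont) auto
      show "(\<lambda>x. D) integrable_on box p q"
        by (simp add: integrable_on_open_interval integrable_const)
      show "norm (f x) \<le> D" if "x \<in> box p q" for x
        using D that box_subset_cbox by fastforce
    qed auto
    then show ?thesis
      using integrable_on_open_interval set_lebesgue_integral_eq_integral(1) by blast
  qed
  show ?thesis
    unfolding has_riemann_integral_def
  proof (intro conjI allI impI)
    fix e :: real
    assume "e > 0"
    \<comment> \<open>\<open>\<eta>\<close> will bound both the oscillation near \<open>T\<close> and the measure of what \<open>T\<close> misses.\<close>
    define \<eta> where "\<eta> = e / (measure lborel (cbox p q) + 2 * D + 1)"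
    have den: "measure lborel (cbox p q) + 2 * D + 1 > 0"
      using D(1) measure_nonneg[of lborel "cbox p q"] by linarith
    then have "\<eta> > 0"
      using \<open>e > 0\<close> by (simp add: \<eta>_def)
    obtain T where T: "closed T" "T \<subseteq> box p q" "box p q - T \<in> lmeasurable"
        "emeasure lebesgue (box p q - T) < ennreal \<eta>"
      using sets_lebesgue_inner_closed[of "box p q" \<eta>] \<open>\<eta> > 0\<close> by auto
    have meas_T: "measure lebesgue (box p q - T) \<le> \<eta>"
      using T(3,4) \<open>\<eta> > 0\<close> by (simp add: emeasure_eq_measure2 ennreal_less_iff)
    have "compact T"
      using T bounded_box bounded_subset compact_eq_bounded_closed by blast
    define \<G> where "\<G> = {U. open U \<and> U \<subseteq> box p q \<and> (\<forall>u\<in>U. \<forall>v\<in>U. \<bar>f u - f v\<bar> < \<eta>)}"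
    have "T \<subseteq> \<Union>\<G>"
    proof
      fix z assume "z \<in> T"
      then have z: "z \<in> box p q"
        using T(2) by blast
      let ?U = "box p q \<inter> f -` ball (f z) (\<eta> / 2)"
      have "open ?U"
        using continuous_open_preimage[OF cont open_box open_ball] .
      moreover have "\<bar>f u - f v\<bar> < \<eta>" if "u \<in> ?U" "v \<in> ?U" for u v
        using that dist_triangle_half_r[of "f z" "f u" \<eta> "f v"] by (auto simp: dist_real_def)
      ultimately have "?U \<in> \<G>"
        unfolding \<G>_def by blast
      then show "z \<in> \<Union>\<G>"
        using z \<open>\<eta> > 0\<close> by (intro UnionI[of ?U]) auto
    qed
    \<comment> \<open>A Lebesgue number of the cover: it controls \<open>f\<close> on balls around points of \<open>T\<close>, even where
      these balls leave \<open>T\<close>, which uniform continuity on \<open>T\<close> alone would not give.\<close>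
    then obtain \<rho> where "\<rho> > 0" and \<rho>: "\<And>z. z \<in> T \<Longrightarrow> \<exists>U\<in>\<G>. ball z \<rho> \<subseteq> U"
      using Heine_Borel_lemma[OF \<open>compact T\<close>, of \<G>] unfolding \<G>_def by blast
    define g where "g = (\<lambda>x. \<eta> + 2 * D * indicat_real (- T) x)"
    have g: "(g has_integral (measure lborel (cbox p q) * \<eta> + 2 * D * measure lebesgue (box p q - T)))
        (cbox p q)"
    proof -
      let ?W = "box p q - T"
      have "(indicat_real ?W has_integral measure lebesgue ?W) UNIV"
        using T(3) by (simp add: lmeasurable_iff_has_integral)
      then have "((\<lambda>x. if x \<in> cbox p q then indicat_real ?W x else 0) has_integral
          measure lebesgue ?W) UNIV"
        by (rule has_integral_eq[rotated]) (use box_subset_cbox in \<open>auto simp: indicator_def\<close>)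
      then have "(indicat_real ?W has_integral measure lebesgue ?W) (cbox p q)"
        by (simp only: has_integral_restrict_UNIV)
      then have "((\<lambda>x. \<eta> + 2 * D * indicat_real ?W x) has_integral
          (measure lborel (cbox p q) * \<eta> + 2 * D * measure lebesgue ?W)) (cbox p q)"
        using has_integral_const[of \<eta> p q] by (intro has_integral_add has_integral_mult_right) auto
      \<comment> \<open>On the boundary of the box, a null set, \<open>g\<close> is larger than this function: the majorant has to
        hold at every point of a cell that misses \<open>T\<close>.\<close>
      then show ?thesis
        by (rule has_integral_spike_interior) (auto simp: g_def indicator_def)
    qed
    have "\<bar>(\<Sum>(x, K)\<in>\<D>. measure lborel K * f x) - integral (cbox p q) f\<bar> < e"
      if \<D>: "\<D> tagged_division_of cbox p q" and fine: "(\<lambda>x. ball x (\<rho> / 2)) fine \<D>" for \<D>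
    proof -
      have cell: "\<bar>measure lborel K * f x - integral K f\<bar> \<le> integral K g" if "(x, K) \<in> \<D>" for x K
      proof -
        obtain u v where K: "K = cbox u v"
          using tagged_division_ofD(4)[OF \<D> \<open>(x, K) \<in> \<D>\<close>] by blast
        have sub: "x \<in> K" "K \<subseteq> cbox p q" "K \<subseteq> ball x (\<rho> / 2)"
          using tagged_division_ofD(2,3)[OF \<D> \<open>(x, K) \<in> \<D>\<close>] fineD[OF fine \<open>(x, K) \<in> \<D>\<close>] by auto
        have int: "f integrable_on K" "g integrable_on K"
          using int_f g sub(2) unfolding K by (blast intro: integrable_on_subcbox)+
        have osc: "norm (f x - f y) \<le> g y" if "y \<in> K" for y
        proof (cases "K \<inter> T = {}")
          case True
          then have "y \<notin> T" using that by blast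
          moreover have "\<bar>f x\<bar> \<le> D" "\<bar>f y\<bar> \<le> D"
            using D(2) sub(1,2) that by blast+
          ultimately show ?thesis
            using \<open>\<eta> > 0\<close> by (simp add: g_def)
        next
          case False
          then obtain z where z: "z \<in> K" "z \<in> T" by blast
          obtain U where U: "U \<in> \<G>" "ball z \<rho> \<subseteq> U"
            using \<rho>[OF z(2)] by blast
          have "w \<in> ball z \<rho>" if "w \<in> K" for w
          proof -
            have "dist x z < \<rho> / 2" "dist x w < \<rho> / 2"
              using sub(3) z(1) that by auto
            then show ?thesis
              using dist_triangle3[of z w x] by simp
          qed
          then have "x \<in> U" "y \<in> U"
            using U(2) sub(1) that by blast+
          then have "\<bar>f x - f y\<bar> < \<eta>"
            using U(1) unfolding \<G>_def by blast
          moreover have "\<eta> \<le> g y"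
            using D(1) by (simp add: g_def)
          ultimately show ?thesis by simp
        qed
        have "norm (integral K (\<lambda>y. f x - f y)) \<le> integral K g"
          by (intro integral_norm_bound_integral int osc) (use int in \<open>auto simp: K intro!: integrable_diff\<close>)
        moreover have "integral K (\<lambda>y. f x - f y) = measure lborel K * f x - integral K f"
          using Henstock_Kurzweil_Integration.integral_diff[OF integrable_const int(1)[unfolded K], of "f x"]
          by (simp add: K)
        ultimately show ?thesis by simp
      qed
      have "(\<Sum>(x, K)\<in>\<D>. measure lborel K * f x) - integral (cbox p q) f
          = (\<Sum>(x, K)\<in>\<D>. measure lborel K * f x - integral K f)"
        by (simp add: integral_combine_tagged_division_topdown[OF int_f \<D>] sum_subtractf
            case_prod_unfold)
      also have "\<bar>\<dots>\<bar> \<le> (\<Sum>(x, K)\<in>\<D>. integral K g)"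
        by (rule order_trans[OF sum_abs]) (use cell in \<open>auto intro!: sum_mono\<close>)
      also have "\<dots> = integral (cbox p q) g"
        using g \<D> by (metis has_integral_integrable integral_combine_tagged_division_topdown)
      also have "\<dots> = measure lborel (cbox p q) * \<eta> + 2 * D * measure lebesgue (box p q - T)"
        using g by (rule integral_unique)
      also have "\<dots> \<le> measure lborel (cbox p q) * \<eta> + 2 * D * \<eta>"
        using D(1) meas_T by (intro add_left_mono mult_left_mono) auto
      also have "\<dots> < (measure lborel (cbox p q) + 2 * D + 1) * \<eta>"
        using \<open>\<eta> > 0\<close> by (simp add: algebra_simps)
      also have "\<dots> = e"
        using den by (simp add: \<eta>_def)
      finally show ?thesis .
    qed
    then show "\<exists>\<delta>>0. \<forall>\<D>. \<D> tagged_division_of cbox p q \<and> (\<lambda>x. ball x \<delta>) fine \<D> \<longrightarrow>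
        \<bar>(\<Sum>(x, K)\<in>\<D>. measure lborel K * f x) - integral (cbox p q) f\<bar> < e"
      using \<open>\<rho> > 0\<close> by (intro exI[of _ "\<rho> / 2"]) auto
  qed auto
qed

section \<open>Separately convex functions of two variables\<close>

definition biconvex_on :: "real set \<Rightarrow> real set \<Rightarrow> (real \<Rightarrow> real \<Rightarrow> real) \<Rightarrow> bool"
  where "biconvex_on A B f \<longleftrightarrow>
    (\<forall>y\<in>B. convex_on A (\<lambda>x. f x y)) \<and> (\<forall>x\<in>A. convex_on B (\<lambda>y. f x y))"

text \<open>
  Taking one of the two weights to be \<open>1\<close> and the two points in that variable equal reduces the
  four-point inclusion to convexity of a section.
\<close>

lemma ivl_coord_convex_on_imp_biconvex_on:
  assumes F: "ivl_coord_convex_on A B F" and "convex A" "convex B"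
  shows biconvex_on_lower: "biconvex_on A B (\<lambda>x y. lower (F x y))"
    and biconvex_on_minus_upper: "biconvex_on A B (\<lambda>x y. - upper (F x y))"
proof -
  have le: "lower (F (t * x + (1 - t) * y) (s * u + (1 - s) * w))
      \<le> t * s * lower (F x u) + t * (1 - s) * lower (F x w)
        + s * (1 - t) * lower (F y u) + (1 - s) * (1 - t) * lower (F y w)"
    and ge: "t * s * upper (F x u) + t * (1 - s) * upper (F x w)
        + s * (1 - t) * upper (F y u) + (1 - s) * (1 - t) * upper (F y w)
      \<le> upper (F (t * x + (1 - t) * y) (s * u + (1 - s) * w))"
    if "x \<in> A" "y \<in> A" "u \<in> B" "w \<in> B" "0 \<le> s" "s \<le> 1" "0 \<le> t" "t \<le> 1" for x y u w s t
  proof -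
    let ?R = "(t * s) *\<^sub>I F x u + (t * (1 - s)) *\<^sub>I F x w
      + (s * (1 - t)) *\<^sub>I F y u + ((1 - s) * (1 - t)) *\<^sub>I F y w"
    have "set_of ?R \<subseteq> set_of (F (t * x + (1 - t) * y) (s * u + (1 - s) * w))"
      using F that unfolding ivl_coord_convex_on_def by auto
    then have "lower (F (t * x + (1 - t) * y) (s * u + (1 - s) * w)) \<le> lower ?R"
      and "upper ?R \<le> upper (F (t * x + (1 - t) * y) (s * u + (1 - s) * w))"
      using lower_le_upper[of ?R] by (auto simp: set_of_eq)
    then show "lower (F (t * x + (1 - t) * y) (s * u + (1 - s) * w))
      \<le> t * s * lower (F x u) + t * (1 - s) * lower (F x w)
        + s * (1 - t) * lower (F y u) + (1 - s) * (1 - t) * lower (F y w)"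
      and "t * s * upper (F x u) + t * (1 - s) * upper (F x w)
        + s * (1 - t) * upper (F y u) + (1 - s) * (1 - t) * upper (F y w)
      \<le> upper (F (t * x + (1 - t) * y) (s * u + (1 - s) * w))"
      using that by (simp_all add: lower_scale_interval upper_scale_interval)
  qed
  have "lower (F (t * x + (1 - t) * y) u) \<le> t * lower (F x u) + (1 - t) * lower (F y u)"
    and "- upper (F (t * x + (1 - t) * y) u) \<le> t * - upper (F x u) + (1 - t) * - upper (F y u)"
    if "x \<in> A" "y \<in> A" "u \<in> B" "0 \<le> t" "t \<le> 1" for x y u t
    using le[OF that(1,2,3,3), of 1 t] ge[OF that(1,2,3,3), of 1 t] that by simp_all
  moreover have "lower (F x (s * u + (1 - s) * w)) \<le> s * lower (F x u) + (1 - s) * lower (F x w)"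
    and "- upper (F x (s * u + (1 - s) * w)) \<le> s * - upper (F x u) + (1 - s) * - upper (F x w)"
    if "x \<in> A" "u \<in> B" "w \<in> B" "0 \<le> s" "s \<le> 1" for x u w s
    using le[OF that(1,1,2,3), of s 1] ge[OF that(1,1,2,3), of s 1] that by simp_all
  ultimately show "biconvex_on A B (\<lambda>x y. lower (F x y))"
    and "biconvex_on A B (\<lambda>x y. - upper (F x y))"
    using assms(2,3) by (simp_all add: biconvex_on_def convex_on_alt)
qed

text \<open>
  The maximum of the corner values is an upper bound. For a lower bound, reflect the point in the two
  axes of the rectangle: the value at the centre is at most the mean over the four reflected
  points, and three of these are already bounded above.
\<close>

lemma biconvex_on_bounded:
  assumes f: "biconvex_on {a..b} {c..d} f"
  obtains C where "\<And>x y. x \<in> {a..b} \<Longrightarrow> y \<in> {c..d} \<Longrightarrow> \<bar>f x y\<bar> \<le> C"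
proof -
  define M where "M = max (max (f a c) (f a d)) (max (f b c) (f b d))"
  have cx: "convex_on {a..b} (\<lambda>x. f x y)" if "y \<in> {c..d}" for y
    using f that by (simp add: biconvex_on_def)
  have cy: "convex_on {c..d} (f x)" if "x \<in> {a..b}" for x
    using f that by (simp add: biconvex_on_def)
  have upper: "f x y \<le> M" if "x \<in> {a..b}" "y \<in> {c..d}" for x y
  proof -
    have "f x y \<le> max (f x c) (f x d)"
      using convex_on_le_max[OF cy] that by blast
    moreover have "f x c \<le> max (f a c) (f b c)" "f x d \<le> max (f a d) (f b d)"
      using convex_on_le_max[OF cx] that by auto
    ultimately show ?thesis
      unfolding M_def by linarith
  qed
  define m where "m = f ((a + b) / 2) ((c + d) / 2)"
  have lower: "4 * m - 3 * M \<le> f x y" if "x \<in> {a..b}" "y \<in> {c..d}" for x y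
  proof -
    define x' y' where "x' = a + b - x" and "y' = c + d - y"
    have in': "x' \<in> {a..b}" "y' \<in> {c..d}" "(a + b) / 2 \<in> {a..b}"
      using that by (auto simp: x'_def y'_def)
    have midpoint: "2 * \<phi> (w / 2) \<le> \<phi> v + \<phi> (w - v)"
      if "convex_on S \<phi>" "v \<in> S" "w - v \<in> S" for S :: "real set" and \<phi> :: "real \<Rightarrow> real" and v w
    proof -
      have "\<phi> ((1 - 1 / 2) *\<^sub>R v + (1 / 2) *\<^sub>R (w - v)) \<le> (1 - 1 / 2) * \<phi> v + 1 / 2 * \<phi> (w - v)"
        using that by (intro convex_onD[OF that(1)]) auto
      moreover have "(1 - 1 / 2) *\<^sub>R v + (1 / 2) *\<^sub>R (w - v) = w / 2"
        by (simp add: field_simps)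
      ultimately have "\<phi> (w / 2) \<le> (1 - 1 / 2) * \<phi> v + 1 / 2 * \<phi> (w - v)"
        by (simp only:)
      then show ?thesis
        by simp
    qed
    have my: "2 * m \<le> f ((a + b) / 2) y + f ((a + b) / 2) y'"
      using midpoint[OF cy[OF in'(3)] that(2)] in'(2) by (simp add: m_def y'_def)
    have mx: "2 * f ((a + b) / 2) z \<le> f x z + f x' z" if "z \<in> {c..d}" for z
      using midpoint[OF cx[OF that] \<open>x \<in> {a..b}\<close>] in'(1) by (simp add: x'_def)
    have "f x' y \<le> M" "f x y' \<le> M" "f x' y' \<le> M"
      using upper that in' by auto
    then show ?thesis
      using my mx[OF that(2)] mx[OF in'(2)] by linarith
  qed
  have "\<bar>f x y\<bar> \<le> \<bar>M\<bar> + \<bar>4 * m - 3 * M\<bar>" if "x \<in> {a..b}" "y \<in> {c..d}" for x y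
    using upper[OF that] lower[OF that] by linarith
  then show ?thesis
    by (rule that)
qed

text \<open>
  Compare \<open>y\<close> with the two end points \<open>z\<close> and \<open>w\<close> of the diameter through it: \<open>y\<close> lies between
  \<open>x\<close> and \<open>z\<close>, which bounds \<open>f y\<close> from above, and \<open>x\<close> lies between \<open>w\<close> and \<open>y\<close>, which bounds \<open>f y\<close>
  from below. The constant depends only on the bound \<open>C\<close> and the radius, so the estimate is uniform
  over families of convex functions.
\<close>

lemma convex_on_cball_lipschitz_at_centre:
  fixes f :: "'a::real_normed_vector \<Rightarrow> real"
  assumes f: "convex_on (cball x r) f" and "r > 0"
    and bound: "\<And>y. y \<in> cball x r \<Longrightarrow> \<bar>f y\<bar> \<le> C"
    and y: "y \<in> cball x r"
  shows "\<bar>f y - f x\<bar> \<le> 2 * C / r * dist x y"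
proof (cases "y = x")
  case False
  define t where "t = dist x y / r"
  have t: "0 < t" "t \<le> 1"
    using False y \<open>r > 0\<close> by (auto simp: t_def)
  define z w where "z = x + (1 / t) *\<^sub>R (y - x)" and "w = x - (1 / t) *\<^sub>R (y - x)"
  have len: "norm ((1 / t) *\<^sub>R (y - x)) = r"
    using False \<open>r > 0\<close> by (simp add: t_def dist_norm norm_minus_commute)
  have zw: "z \<in> cball x r" "w \<in> cball x r"
    using len by (auto simp: z_def w_def dist_norm)
  have x: "x \<in> cball x r"
    using \<open>r > 0\<close> by simp
  have "f y \<le> (1 - t) * f x + t * f z"
  proof -
    have "(1 - t) *\<^sub>R x + t *\<^sub>R z = y"
      using t by (simp add: z_def algebra_simps)
    then show ?thesis
      using convex_onD[OF f, of t x z] t x zw by simp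
  qed
  then have "f y - f x \<le> t * (f z - f x)"
    by (simp add: algebra_simps)
  also have "\<dots> \<le> t * (2 * C)"
    using t bound[OF x] bound[OF zw(1)] by (intro mult_left_mono) auto
  finally have up: "f y - f x \<le> t * (2 * C)" .
  have "(1 + t) * f x \<le> f y + t * f w"
  proof -
    have s: "1 - t / (1 + t) = 1 / (1 + t)"
      using t by (simp add: field_simps)
    have "y + t *\<^sub>R w = (1 + t) *\<^sub>R x"
      using t by (simp add: w_def algebra_simps)
    then have "(1 / (1 + t)) *\<^sub>R (y + t *\<^sub>R w) = x"
      using t by simp
    then have "(1 / (1 + t)) *\<^sub>R y + (t / (1 + t)) *\<^sub>R w = x"
      by (simp add: scaleR_right_distrib)
    then have "f x \<le> (1 / (1 + t)) * f y + (t / (1 + t)) * f w"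
      using convex_onD[OF f, of "t / (1 + t)" y w] t y zw s by simp
    then have "f x \<le> (f y + t * f w) / (1 + t)"
      by (simp add: add_divide_distrib)
    then show ?thesis
      using t by (simp add: pos_le_divide_eq mult.commute)
  qed
  then have "f x - f y \<le> t * (f w - f x)"
    by (simp add: algebra_simps)
  also have "\<dots> \<le> t * (2 * C)"
    using t bound[OF x] bound[OF zw(2)] by (intro mult_left_mono) auto
  finally have "\<bar>f y - f x\<bar> \<le> t * (2 * C)"
    using up by linarith
  then show ?thesis
    by (simp add: t_def mult_ac)
qed simp

text \<open>
  Move from \<open>(x0, y0)\<close> to \<open>(x, y)\<close> along the two coordinate directions. The section
  \<open>\<lambda>x. f x y\<close> varies with \<open>y\<close>, so continuity of the individual sections would not suffice; the
  Lipschitz constant at the centre does not depend on \<open>y\<close>.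
\<close>

lemma biconvex_on_continuous_on_box:
  assumes f: "biconvex_on {a..b} {c..d} f"
  shows "continuous_on (box (a, c) (b, d)) (\<lambda>(x, y). f x y)"
proof -
  obtain C where C: "\<And>x y. x \<in> {a..b} \<Longrightarrow> y \<in> {c..d} \<Longrightarrow> \<bar>f x y\<bar> \<le> C"
    using biconvex_on_bounded[OF f] by blast
  have "isCont (\<lambda>(x, y). f x y) (x0, y0)" if "(x0, y0) \<in> box (a, c) (b, d)" for x0 y0
  proof -
    have in0: "a < x0" "x0 < b" "c < y0" "y0 < d"
      using that by (auto simp: box_prod)
    define r where "r = min (min (x0 - a) (b - x0)) (min (y0 - c) (d - y0))"
    have "r > 0"
      using in0 by (simp add: r_def)
    have r_le: "r \<le> x0 - a" "r \<le> b - x0" "r \<le> y0 - c" "r \<le> d - y0"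
      by (simp_all add: r_def)
    then have sub: "cball x0 r \<subseteq> {a..b}" "cball y0 r \<subseteq> {c..d}"
      using r_le by (auto simp: cball_eq_atLeastAtMost)
    have lip: "\<bar>f x y - f x0 y0\<bar> \<le> 2 * C / r * dist x0 x + 2 * C / r * dist y0 y"
      if "x \<in> cball x0 r" "y \<in> cball y0 r" for x y
    proof -
      have in1: "y \<in> {c..d}" "x0 \<in> {a..b}"
        using that sub in0 by auto
      have "convex_on {a..b} (\<lambda>x. f x y)" "convex_on {c..d} (f x0)"
        using f in1 by (auto simp: biconvex_on_def)
      then have cx: "convex_on (cball x0 r) (\<lambda>x. f x y)" and cy: "convex_on (cball y0 r) (f x0)"
        using sub by (auto intro: convex_on_subset)
      have "\<bar>f x y - f x0 y\<bar> \<le> 2 * C / r * dist x0 x"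
        using C in1(1) sub(1) that(1)
        by (intro convex_on_cball_lipschitz_at_centre[OF cx \<open>r > 0\<close>]) blast+
      moreover have "\<bar>f x0 y - f x0 y0\<bar> \<le> 2 * C / r * dist y0 y"
        using C in1(2) sub(2) that(2)
        by (intro convex_on_cball_lipschitz_at_centre[OF cy \<open>r > 0\<close>]) blast+
      ultimately show ?thesis by linarith
    qed
    have ev: "\<forall>\<^sub>F z in at (x0, y0).
        norm (f (fst z) (snd z) - f x0 y0) \<le> 2 * C / r * dist x0 (fst z) + 2 * C / r * dist y0 (snd z)"
    proof -
      have "\<forall>\<^sub>F z in at (x0, y0). dist z (x0, y0) < r"
        using \<open>r > 0\<close> by (auto simp: eventually_at)
      then show ?thesis
      proof eventually_elim
        case (elim z)
        then have "fst z \<in> cball x0 r" "snd z \<in> cball y0 r"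
          using dist_fst_le[of z "(x0, y0)"] dist_snd_le[of z "(x0, y0)"]
          by (auto simp: dist_commute)
        then show ?case
          using lip by simp
      qed
    qed
    have "((\<lambda>z. 2 * C / r * dist x0 (fst z) + 2 * C / r * dist y0 (snd z)) \<longlongrightarrow>
        2 * C / r * dist x0 (fst (x0, y0)) + 2 * C / r * dist y0 (snd (x0, y0))) (at (x0, y0))"
      by (intro tendsto_intros)
    then have "((\<lambda>z. f (fst z) (snd z) - f x0 y0) \<longlongrightarrow> 0) (at (x0, y0))"
      by (intro Lim_null_comparison[OF ev]) simp
    then show ?thesis
      by (simp add: isCont_def case_prod_unfold LIM_zero_iff)
  qed
  then show ?thesis
    by (auto intro!: continuous_at_imp_continuous_on)
qed

section \<open>Bilinear interpolation of corner values\<close>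

definition interp :: "real \<Rightarrow> real \<Rightarrow> real \<Rightarrow> real \<Rightarrow> real \<Rightarrow> real"
  where "interp a b p q x = ((b - x) * p + (x - a) * q) / (b - a)"

definition bilinear_interp ::
    "real \<Rightarrow> real \<Rightarrow> real \<Rightarrow> real \<Rightarrow> (real \<Rightarrow> real \<Rightarrow> real) \<Rightarrow> real \<Rightarrow> real \<Rightarrow> real"
  where "bilinear_interp a b c d f x y =
    interp c d (interp a b (f a c) (f b c) x) (interp a b (f a d) (f b d) x) y"

lemma interp_mono:
  assumes "p \<le> p'" "q \<le> q'" "x \<in> {a..b}"
  shows "interp a b p q x \<le> interp a b p' q' x"
  unfolding interp_def using assms by (intro divide_right_mono add_mono mult_left_mono) auto

lemma interp_minus: "interp a b (- p) (- q) x = - interp a b p q x"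
  by (simp add: interp_def minus_divide_left algebra_simps)

lemma interp_nonneg: "0 \<le> p \<Longrightarrow> 0 \<le> q \<Longrightarrow> x \<in> {a..b} \<Longrightarrow> 0 \<le> interp a b p q x"
  by (simp add: interp_def)

lemma bilinear_interp_minus:
  "bilinear_interp a b c d (\<lambda>x y. - f x y) x y = - bilinear_interp a b c d f x y"
  by (simp add: bilinear_interp_def interp_minus)

lemma convex_on_le_interp:
  assumes f: "convex_on {a..b} f" and "a < b" and x: "x \<in> {a..b}"
  shows "f x \<le> interp a b (f a) (f b) x"
  using convex_onD_Icc'[OF f x] \<open>a < b\<close> by (simp add: interp_def field_simps)

text \<open>
  Interpolate in \<open>y\<close> first, then replace the two values on the horizontal edges by their
  interpolants in \<open>x\<close>.
\<close>

lemma biconvex_on_le_bilinear_interp: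
  assumes f: "biconvex_on {a..b} {c..d} f" and "a < b" "c < d"
    and xy: "x \<in> {a..b}" "y \<in> {c..d}"
  shows "f x y \<le> bilinear_interp a b c d f x y"
proof -
  have "f x y \<le> interp c d (f x c) (f x d) y"
    using f assms by (intro convex_on_le_interp) (auto simp: biconvex_on_def)
  also have "\<dots> \<le> bilinear_interp a b c d f x y"
    unfolding bilinear_interp_def using f assms
    by (intro interp_mono convex_on_le_interp[where f = "\<lambda>x. f x z" for z]) (auto simp: biconvex_on_def)
  finally show ?thesis .
qed

text \<open>
  The Gram matrix of the two hat functions on \<open>[a, b]\<close>: diagonal entries \<open>(b - a) / 3\<close>,
  off-diagonal entries \<open>(b - a) / 6\<close>.
\<close>

lemma has_integral_interp_mult_interp:
  assumes "a < b"
  shows "((\<lambda>x. interp a b p q x * interp a b r s x) has_integral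
    (b - a) * (p * r / 3 + q * s / 3 + p * s / 6 + q * r / 6)) {a..b}"
proof -
  define h k l where "h = b - a" and "k = (q - p) / h" and "l = (s - r) / h"
  have "h > 0"
    using assms by (simp add: h_def)
  have kl: "k * h = q - p" "l * h = s - r"
    using \<open>h > 0\<close> by (simp_all add: k_def l_def)
  have interp: "interp a b u v x = u + (v - u) / h * (x - a)" for u v x
  proof -
    have "(b - x) * u + (x - a) * v = h * u + (v - u) * (x - a)"
      by (simp add: h_def algebra_simps)
    then show ?thesis
      using \<open>h > 0\<close> by (simp add: interp_def add_divide_distrib flip: h_def)
  qed
  \<comment> \<open>An antiderivative, from expanding the product \<open>(p + k X) (r + l X)\<close> in powers of \<open>X = x - a\<close>.\<close>
  define \<Phi> where "\<Phi> x = p * r * (x - a) + (p * l + r * k) * (x - a)^2 / 2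
      + k * l * (x - a)^3 / 3" for x
  have "(\<Phi> has_real_derivative (p + k * (x - a)) * (r + l * (x - a))) (at x within {a..b})" for x
    unfolding \<Phi>_def
    by (auto intro!: derivative_eq_intros simp: field_simps power2_eq_square)
  then have "((\<lambda>x. interp a b p q x * interp a b r s x) has_integral (\<Phi> b - \<Phi> a)) {a..b}"
    unfolding interp k_def[symmetric] l_def[symmetric]
    using assms by (intro fundamental_theorem_of_calculus)
      (auto simp: has_real_derivative_iff_has_vector_derivative)
  moreover have "\<Phi> b - \<Phi> a = h * (p * r + (p * (l * h) + r * (k * h)) / 2 + (k * h) * (l * h) / 3)"
    unfolding \<Phi>_def h_def[symmetric] by (simp add: algebra_simps power2_eq_square power3_eq_cube)
  moreover have "p * r + (p * (l * h) + r * (k * h)) / 2 + (k * h) * (l * h) / 3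
      = p * r / 3 + q * s / 3 + p * s / 6 + q * r / 6"
    unfolding kl by (simp add: field_simps)
  ultimately show ?thesis
    by (simp add: h_def)
qed

text \<open>
  The right-hand side of the inequality, for real-valued functions: since the weights sum to \<open>1\<close>, it
  is a weighted mean of the sixteen products of corner values.
\<close>

definition corner_mean ::
    "real \<Rightarrow> real \<Rightarrow> real \<Rightarrow> real \<Rightarrow> (real \<Rightarrow> real \<Rightarrow> real) \<Rightarrow> (real \<Rightarrow> real \<Rightarrow> real) \<Rightarrow> real"
  where "corner_mean a b c d f g =
    (f a c * g a c + f a d * g a d + f b c * g b c + f b d * g b d) / 9
    + (f a c * g a d + f a d * g a c + f b c * g b d + f b d * g b c
      + f b c * g a c + f a c * g b c + f b d * g a d + f a d * g b d) / 18
    + (f b c * g a d + f a d * g b c + f b d * g a c + f a c * g b d) / 36"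

text \<open>
  For fixed \<open>x\<close> both factors are affine in \<open>y\<close>, with end values \<open>?p x\<close>, \<open>?q x\<close> and
  \<open>?r x\<close>, \<open>?s x\<close> that are affine in \<open>x\<close>. The one-dimensional formula thus applies first in \<open>y\<close> and
  then to each of the four resulting products.
\<close>

lemma has_integral_bilinear_interp_mult:
  assumes "a < b" "c < d"
  shows "((\<lambda>(x, y). bilinear_interp a b c d f x y * bilinear_interp a b c d g x y) has_integral
    (b - a) * (d - c) * corner_mean a b c d f g) (cbox (a, c) (b, d))"
proof -
  let ?h = "\<lambda>(x, y). bilinear_interp a b c d f x y * bilinear_interp a b c d g x y"
  let ?X = "\<lambda>u v w z. u * w / 3 + v * z / 3 + u * z / 6 + v * w / 6"
  let ?p = "interp a b (f a c) (f b c)" and ?q = "interp a b (f a d) (f b d)"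
  let ?r = "interp a b (g a c) (g b c)" and ?s = "interp a b (g a d) (g b d)"
  let ?ac_ac = "?X (f a c) (f b c) (g a c) (g b c)" and ?ad_ad = "?X (f a d) (f b d) (g a d) (g b d)"
  let ?ac_ad = "?X (f a c) (f b c) (g a d) (g b d)" and ?ad_ac = "?X (f a d) (f b d) (g a c) (g b c)"
  have cont: "continuous_on (cbox (a, c) (b, d)) ?h"
    unfolding bilinear_interp_def interp_def case_prod_unfold
    using assms by (intro continuous_intros) auto
  have inner: "integral (cbox c d) (\<lambda>y. ?h (x, y))
      = (d - c) * (?p x * ?r x / 3 + ?q x * ?s x / 3 + ?p x * ?s x / 6 + ?q x * ?r x / 6)" for x
    using has_integral_interp_mult_interp[OF assms(2), of "?p x" "?q x" "?r x" "?s x"]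
    by (simp add: bilinear_interp_def integral_unique)
  have outer: "((\<lambda>x. (d - c) * (?p x * ?r x / 3 + ?q x * ?s x / 3 + ?p x * ?s x / 6 + ?q x * ?r x / 6))
      has_integral (d - c) * ((b - a) * ?ac_ac / 3 + (b - a) * ?ad_ad / 3
        + (b - a) * ?ac_ad / 6 + (b - a) * ?ad_ac / 6)) {a..b}"
    by (intro has_integral_mult_right has_integral_add has_integral_divide
        has_integral_interp_mult_interp assms(1))
  have factor: "(d - c) * ((b - a) * A / 3 + (b - a) * B / 3 + (b - a) * C / 6 + (b - a) * D / 6)
      = (b - a) * (d - c) * (A / 3 + B / 3 + C / 6 + D / 6)" for A B C D
    by (simp add: field_simps)
  have mean: "?ac_ac / 3 + ?ad_ad / 3 + ?ac_ad / 6 + ?ad_ac / 6 = corner_mean a b c d f g"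
    by (simp add: corner_mean_def add_divide_distrib)
  have "integral (cbox (a, c) (b, d)) ?h = integral {a..b} (\<lambda>x. integral (cbox c d) (\<lambda>y. ?h (x, y)))"
    using integral_prod_continuous[OF cont] by (simp only: box_real)
  also have "\<dots> = (b - a) * (d - c) * corner_mean a b c d f g"
    using integral_unique[OF outer] by (simp only: inner factor mean)
  finally have "integral (cbox (a, c) (b, d)) ?h = (b - a) * (d - c) * corner_mean a b c d f g" .
  then show ?thesis
    using integrable_continuous[OF cont] by (metis integrable_integral)
qed

section \<open>The product of two interval-valued co-ordinated convex functions\<close>

lemma has_riemann_integral_biconvex_mult:
  assumes f: "biconvex_on {a..b} {c..d} f" and g: "biconvex_on {a..b} {c..d} g"
    and h: "\<And>x y. x \<in> {a..b} \<Longrightarrow> y \<in> {c..d} \<Longrightarrow> h (x, y) = f x y * g x y"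
  shows "has_riemann_integral h (integral ({a..b} \<times> {c..d}) h) ({a..b} \<times> {c..d})"
proof -
  obtain Cf Cg where C: "\<And>x y. x \<in> {a..b} \<Longrightarrow> y \<in> {c..d} \<Longrightarrow> \<bar>f x y\<bar> \<le> Cf"
      "\<And>x y. x \<in> {a..b} \<Longrightarrow> y \<in> {c..d} \<Longrightarrow> \<bar>g x y\<bar> \<le> Cg"
    using biconvex_on_bounded[OF f] biconvex_on_bounded[OF g] by metis
  have box: "{a..b} \<times> {c..d} = cbox (a, c) (b, d)"
    by (simp add: cbox_Pair_eq)
  have "continuous_on (box (a, c) (b, d)) (\<lambda>z. (case z of (x, y) \<Rightarrow> f x y) * (case z of (x, y) \<Rightarrow> g x y))"
    by (intro continuous_intros biconvex_on_continuous_on_box f g)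
  then have "continuous_on (box (a, c) (b, d)) h"
    by (rule continuous_on_eq) (use h in \<open>auto simp: box_prod\<close>)
  moreover have "\<bar>h z\<bar> \<le> Cf * Cg" if z_in: "z \<in> cbox (a, c) (b, d)" for z
  proof -
    obtain x y where z: "z = (x, y)" "x \<in> {a..b}" "y \<in> {c..d}"
      using z_in by (cases z) auto
    show ?thesis
      using C[OF z(2,3)] by (simp add: z(1) h[OF z(2,3)] abs_mult mult_mono)
  qed
  ultimately show ?thesis
    unfolding box by (rule has_riemann_integral_if_continuous_on_box)
qed

theorem theorem8:
  fixes a b c d :: real
    and F G :: "real \<Rightarrow> real \<Rightarrow> real interval"
  assumes "a < b" and "c < d"
    and "\<forall>x\<in>{a..b}. \<forall>y\<in>{c..d}. pos_interval (F x y)"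
    and "\<forall>x\<in>{a..b}. \<forall>y\<in>{c..d}. pos_interval (G x y)"
    and "ivl_coord_convex_on {a..b} {c..d} F"
    and "ivl_coord_convex_on {a..b} {c..d} G"
  shows "ivl_integrable_on (\<lambda>(x, y). F x y * G x y) ({a..b} \<times> {c..d}) \<and>
    set_of ((1 / ((b - a) * (d - c))) *\<^sub>I
        ivl_integral ({a..b} \<times> {c..d}) (\<lambda>(x, y). F x y * G x y)) \<supseteq>
    set_of ((1 / 9) *\<^sub>I P_sum F G a b c d + (1 / 18) *\<^sub>I M_sum F G a b c d
        + (1 / 36) *\<^sub>I N_sum F G a b c d)"
proof -
  let ?S = "{a..b} \<times> {c..d}"
  let ?H = "\<lambda>(x, y). F x y * G x y"
  let ?L = "\<lambda>F x y. lower (F x y) :: real" and ?U = "\<lambda>F x y. upper (F x y) :: real"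
  let ?B = "bilinear_interp a b c d"
  let ?area = "(b - a) * (d - c)"
  let ?R = "(1 / 9) *\<^sub>I P_sum F G a b c d + (1 / 18) *\<^sub>I M_sum F G a b c d
    + (1 / 36) *\<^sub>I N_sum F G a b c d"
  have S: "?S = cbox (a, c) (b, d)"
    by (simp add: cbox_Pair_eq)
  have area: "?area > 0"
    using assms(1,2) by simp
  have posF: "pos_interval (F x y)" and posG: "pos_interval (G x y)"
    if "x \<in> {a..b}" "y \<in> {c..d}" for x y
    using assms(3,4) that by auto
  have pos: "0 < ?L F x y" "0 < ?L G x y" "0 < ?U F x y" "0 < ?U G x y"
    if "x \<in> {a..b}" "y \<in> {c..d}" for x y
    using posF[OF that] posG[OF that] lower_le_upper[of "F x y"] lower_le_upper[of "G x y"]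
    unfolding pos_interval_def by linarith+
  have prod: "lower (F x y * G x' y') = ?L F x y * ?L G x' y'"
    "upper (F x y * G x' y') = ?U F x y * ?U G x' y'"
    if "x \<in> {a..b}" "y \<in> {c..d}" "x' \<in> {a..b}" "y' \<in> {c..d}" for x y x' y'
    using posF[OF that(1,2)] posG[OF that(3,4)] by (simp_all add: lower_times_pos upper_times_pos)
  note lowF = biconvex_on_lower[OF assms(5) convex_real_interval(5) convex_real_interval(5)]
    and lowG = biconvex_on_lower[OF assms(6) convex_real_interval(5) convex_real_interval(5)]
    and uppF = biconvex_on_minus_upper[OF assms(5) convex_real_interval(5) convex_real_interval(5)]
    and uppG = biconvex_on_minus_upper[OF assms(6) convex_real_interval(5) convex_real_interval(5)]

  have RL: "has_riemann_integral (\<lambda>z. lower (?H z)) (integral ?S (\<lambda>z. lower (?H z))) ?S"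
    by (rule has_riemann_integral_biconvex_mult[OF lowF lowG]) (simp add: prod)
  \<comment> \<open>The product of the upper end points is the product of their negatives, which are biconvex.\<close>
  have RU: "has_riemann_integral (\<lambda>z. upper (?H z)) (integral ?S (\<lambda>z. upper (?H z))) ?S"
    by (rule has_riemann_integral_biconvex_mult[OF uppF uppG]) (simp add: prod)
  have integrable: "ivl_integrable_on ?H ?S"
    using RL RU unfolding ivl_integrable_on_def by blast
  then obtain J where J: "has_ivl_integral ?H J ?S"
    by (auto simp: ivl_integrable_on_iff)
  have intL: "((\<lambda>z. lower (?H z)) has_integral lower J) ?S"
    and intU: "((\<lambda>z. upper (?H z)) has_integral upper J) ?S"
    using J by (auto simp: has_ivl_integral_def intro: has_riemann_integral_imp_has_integral)

  have low: "lower J \<le> ?area * corner_mean a b c d (?L F) (?L G)"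
  proof (rule has_integral_le[OF intL])
    show "((\<lambda>(x, y). ?B (?L F) x y * ?B (?L G) x y) has_integral
        ?area * corner_mean a b c d (?L F) (?L G)) ?S"
      unfolding S by (rule has_integral_bilinear_interp_mult[OF assms(1,2)])
    fix z assume "z \<in> ?S"
    then obtain x y where z: "z = (x, y)" and xy: "x \<in> {a..b}" "y \<in> {c..d}" by auto
    have "?L F x y * ?L G x y \<le> ?B (?L F) x y * ?B (?L G) x y"
      using biconvex_on_le_bilinear_interp[OF lowF assms(1,2) xy]
        biconvex_on_le_bilinear_interp[OF lowG assms(1,2) xy] pos[OF xy]
      by (intro mult_mono) auto
    then show "lower (?H z) \<le> (\<lambda>(x, y). ?B (?L F) x y * ?B (?L G) x y) z"
      using xy by (simp add: z prod)
  qed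
  have upp: "?area * corner_mean a b c d (?U F) (?U G) \<le> upper J"
  proof (rule has_integral_le[OF _ intU])
    show "((\<lambda>(x, y). ?B (?U F) x y * ?B (?U G) x y) has_integral
        ?area * corner_mean a b c d (?U F) (?U G)) ?S"
      unfolding S by (rule has_integral_bilinear_interp_mult[OF assms(1,2)])
    fix z assume "z \<in> ?S"
    then obtain x y where z: "z = (x, y)" and xy: "x \<in> {a..b}" "y \<in> {c..d}" by auto
    have "0 \<le> ?B (?U G) x y"
      unfolding bilinear_interp_def using xy pos assms(1,2)
      by (intro interp_nonneg) (auto intro!: less_imp_le)
    then have "?B (?U F) x y * ?B (?U G) x y \<le> ?U F x y * ?U G x y"
      using biconvex_on_le_bilinear_interp[OF uppF assms(1,2) xy]
        biconvex_on_le_bilinear_interp[OF uppG assms(1,2) xy] pos[OF xy]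
      by (intro mult_mono) (auto simp: bilinear_interp_minus)
    then show "(\<lambda>(x, y). ?B (?U F) x y * ?B (?U G) x y) z \<le> upper (?H z)"
      using xy by (simp add: z prod)
  qed
  have "lower ?R = corner_mean a b c d (?L F) (?L G)"
    and "upper ?R = corner_mean a b c d (?U F) (?U G)"
    using assms(1,2) by (simp_all add: lower_scale_interval upper_scale_interval
        P_sum_def M_sum_def N_sum_def corner_mean_def prod)
  moreover have "lower ((1 / ?area) *\<^sub>I J) = lower J / ?area"
    and "upper ((1 / ?area) *\<^sub>I J) = upper J / ?area"
    using area by (simp_all add: lower_scale_interval upper_scale_interval)
  moreover have "lower J / ?area \<le> corner_mean a b c d (?L F) (?L G)"
    and "corner_mean a b c d (?U F) (?U G) \<le> upper J / ?area"
    using low upp area by (simp_all only: pos_divide_le_eq pos_le_divide_eq mult.commute)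
  ultimately have "set_of ?R \<subseteq> set_of ((1 / ?area) *\<^sub>I J)"
    by (simp add: set_of_eq)
  then show ?thesis
    using integrable ivl_integral_eq[OF J] by simp
qed

end
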